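(* Let $\mathbb{K}$ be a finite field of characteristic different from $2$ and let $(a,b)\in(\mathbb{K}^* )^2$ with $a\neq b$ and $a,b\notin\{1_{\mathbb{K}},-1_{\mathbb{K}}\}$. If neither $\Delta_1:=a^2+4_{\mathbb{K}}ab^{-1}(ab^{-1}-1_{\mathbb{K}})$ nor $\Delta_2:=b^2+4_{\mathbb{K}}a^{-1}b(a^{-1}b-1_{\mathbb{K}})$ is a square in $\mathbb{K}$, then the $(a,b)$-dynomial minimal solution of $(E_{\mathbb{K}})$ is irreducible.
   Context: Let $A$ be a commutative unital ring ($0_A\neq 1_A$); $k_A$ denotes $1_A+\cdots+1_A$ ($k$ terms). For $a_1,\ldots,a_n\in A$ set $M_n(a_1,\ldots,a_n)=\begin{pmatrix} a_n & -1_A\\ 1_A & 0_A\end{pmatrix}\cdots\begin{pmatrix} a_1 & -1_A\\ 1_A & 0_A\end{pmatrix}$. An $n$-tuple is a solution of $(E_A)$ if $M_n(a_1,\ldots,a_n)=\pm \mathrm{Id}$. For tuples, $(a_1,\ldots,a_n)\oplus(b_1,\ldots,b_m)=(a_1+b_m,a_2,\ldots,a_{n-1},a_n+b_1,b_2,\ldots,b_{m-1})$. Write $(a_1,\ldots,a_n)\sim(b_1,\ldots,b_n)$ if $(b_1,\ldots,b_n)$ is obtained from $(a_1,\ldots,a_n)$ or from $(a_n,\ldots,a_1)$ by a cyclic permutation. A solution $(c_1,\ldots,c_n)$ with $n\geq 3$ is reducible if there exist a solution $(b_1,\ldots,b_l)$ and a tuple $(a_1,\ldots,a_m)$ of elements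 of $A$ with $l,m\geq 3$ and $(c_1,\ldots,c_n)\sim(a_1,\ldots,a_m)\oplus(b_1,\ldots,b_l)$; otherwise it is irreducible. For $A$ finite and $a,b\in A$ with $a\neq b$, the $(a,b)$-dynomial minimal solution of $(E_A)$ is the solution of the form $(a,b,a,b,\ldots,a,b)$ (the pair $(a,b)$ repeated $k\geq 1$ times) of minimal size; it exists. *)

theory Defs
  imports "HOL-Analysis.Analysis" "HOL-Computational_Algebra.Computational_Algebra"
begin

definition elementary_matrix :: "'a::comm_ring_1 \<Rightarrow> 'a^2^2" where
  "elementary_matrix a = vector [vector [a, -1], vector [1, 0]]"

text \<open>The factors appear in reverse order: the matrix of \<open>[a\<^sub>1, \<dots>, a\<^sub>n]\<close> is the product
  of the elementary matrices of \<open>a\<^sub>n\<close>, \<open>\<dots>\<close>, \<open>a\<^sub>1\<close>, from left to right.\<close>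

primrec Mn :: "'a::comm_ring_1 list \<Rightarrow> 'a^2^2" where
  "Mn [] = mat 1"
| "Mn (a # as) = Mn as ** elementary_matrix a"

definition is_solution :: "'a::comm_ring_1 list \<Rightarrow> bool" where
  "is_solution as \<longleftrightarrow> Mn as = mat 1 \<or> Mn as = - mat 1"

text \<open>This is the operation \<open>\<oplus>\<close> on tuples. It is meaningful for lists of length at least two,
  and below it is applied only to lists of length at least three.\<close>

definition tuple_sum :: "'a::comm_ring_1 list \<Rightarrow> 'a list \<Rightarrow> 'a list" where
  "tuple_sum as bs =
     [hd as + last bs] @ butlast (tl as) @ [last as + hd bs] @ butlast (tl bs)"

definition tuple_equiv :: "'a list \<Rightarrow> 'a list \<Rightarrow> bool" where
  "tuple_equiv as bs \<longleftrightarrow> (\<exists>k. bs = rotate k as \<or> bs = rotate k (rev as))"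

definition reducible_solution :: "'a::comm_ring_1 list \<Rightarrow> bool" where
  "reducible_solution cs \<longleftrightarrow> is_solution cs \<and> length cs \<ge> 3 \<and>
     (\<exists>as bs. length as \<ge> 3 \<and> length bs \<ge> 3 \<and> is_solution bs \<and>
        tuple_equiv cs (tuple_sum as bs))"

definition irreducible_solution :: "'a::comm_ring_1 list \<Rightarrow> bool" where
  "irreducible_solution cs \<longleftrightarrow> is_solution cs \<and> length cs \<ge> 3 \<and> \<not> reducible_solution cs"

definition dynomial :: "'a \<Rightarrow> 'a \<Rightarrow> nat \<Rightarrow> 'a list" where
  "dynomial a b k = concat (replicate k [a, b])"

text \<open>Over a finite ring the least \<open>k\<close> below exists, because the matrix of \<open>[a, b]\<close> is
  invertible and so has finite order.\<close>

definition dynomial_minimal_solution :: "'a::{comm_ring_1,finite} \<Rightarrow> 'a \<Rightarrow> 'a list" where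
  "dynomial_minimal_solution a b =
     dynomial a b (LEAST k. k \<ge> 1 \<and> is_solution (dynomial a b k))"

end

theory Submission
  imports Defs
begin

text \<open>Let \<open>P\<close> be the matrix of \<open>(a, b)\<close>, of trace \<open>t = ab - 2\<close> and determinant \<open>1\<close>. By
  Cayley--Hamilton every power of \<open>P\<close> is \<open>uP + v\<close> with \<open>u\<^sup>2 + tuv + v\<^sup>2 = 1\<close>. If the
  minimal dynomial solution were reducible, there would be a solution \<open>(x, w, y)\<close> with \<open>w\<close> an
  alternating word that is at least three entries shorter, and then the upper left entry of the
  matrix of \<open>w\<close> is \<open>\<plusminus>1\<close>. For \<open>w\<close> of even length \<open>2k\<close> this gives \<open>u(tu + v) = 0\<close>,
  so \<open>P\<^sup>k\<close> or \<open>P\<^sup>k\<^sup>+\<^sup>1\<close> is \<open>\<plusminus>Id\<close>, against minimality. For \<open>w\<close> of odd length, it says that \<open>1/a\<close> or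
  \<open>1/b\<close> is, up to sign, a value of \<open>u\<close>, and then the discriminant of the quadratic equation for
  \<open>v\<close> is a square.\<close>

lemma matrix_mult_nth_2:
  fixes A B :: "'a::semiring_1^2^2"
  shows "(A ** B) $ i $ j = A $ i $ 1 * B $ 1 $ j + A $ i $ 2 * B $ 2 $ j"
  by (simp add: matrix_matrix_mult_def sum_2)

lemma elementary_matrix_nth [simp]:
  "elementary_matrix a $ 1 $ 1 = a" "elementary_matrix a $ 1 $ 2 = -1"
  "elementary_matrix a $ 2 $ 1 = 1" "elementary_matrix a $ 2 $ 2 = 0"
  by (simp_all add: elementary_matrix_def)

lemma Mn_append: "Mn (xs @ ys) = Mn ys ** Mn xs"
  by (induction xs) (simp_all add: matrix_mul_assoc)

text \<open>The two outer factors pick out a single entry of the inner product, whatever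
  \<open>x\<close> and \<open>y\<close> are. This removes the unknown end entries of a summand from
  the argument.\<close>

lemma is_solution_upper_left:
  assumes "is_solution (x # w @ [y])"
  shows "Mn w $ 1 $ 1 = 1 \<or> Mn w $ 1 $ 1 = -1"
proof -
  have "Mn (x # w @ [y]) $ 2 $ 2 = - (Mn w $ 1 $ 1)"
    by (simp add: Mn_append matrix_mult_nth_2)
  moreover have "Mn (x # w @ [y]) $ 2 $ 2 = 1 \<or> Mn (x # w @ [y]) $ 2 $ 2 = -1"
    using assms by (auto simp: is_solution_def mat_def)
  ultimately show ?thesis
    by (metis minus_minus)
qed

text \<open>Rotation turns a product \<open>A ** B\<close> into \<open>B ** A\<close>, and one-sided
  inverses of square matrices over a field are two-sided; for \<open>- mat 1\<close> the sign is
  moved into one factor.\<close>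

lemma is_solution_rotate1:
  fixes xs :: "'a::field list"
  assumes "is_solution xs"
  shows "is_solution (rotate1 xs)"
proof (cases xs)
  case (Cons x ys)
  have comm: "A ** B = mat 1 \<longleftrightarrow> B ** A = mat 1" for A B :: "'a^2^2"
    by (rule matrix_left_right_inverse)
  have neg: "A ** (- B) = - (A ** B)" "(- A) ** B = - (A ** B)" for A B :: "'a^2^2"
    by (simp_all add: vec_eq_iff matrix_mult_nth_2)
  have "A ** B = - mat 1 \<longleftrightarrow> B ** A = - mat 1" for A B :: "'a^2^2"
    using comm[of A "- B"] unfolding neg by (metis minus_minus)
  with comm assms show ?thesis
    by (auto simp: Cons is_solution_def Mn_append)
qed (use assms in simp)

lemma dynomial_simps [simp]:
  "dynomial a b 0 = []" "dynomial a b (Suc k) = a # b # dynomial a b k"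
  by (simp_all add: dynomial_def)

lemma dynomial_add: "dynomial a b (i + j) = dynomial a b i @ dynomial a b j"
  by (simp add: dynomial_def replicate_add)

lemma length_dynomial [simp]: "length (dynomial a b k) = 2 * k"
  by (induction k) simp_all

lemma dynomial_snoc: "dynomial a b k @ [a] = a # dynomial b a k"
  by (induction k) simp_all

lemma rotate1_dynomial: "rotate1 (dynomial a b k) = dynomial b a k"
  by (cases k) (simp_all add: dynomial_snoc)

lemma rotate_dynomial: "rotate m (dynomial a b k) \<in> {dynomial a b k, dynomial b a k}"
  by (induction m) (auto simp: rotate1_dynomial)

lemma rev_dynomial: "rev (dynomial a b k) = dynomial b a k"
proof (induction k)
  case (Suc k)
  then show ?case
    using dynomial_add[of b a k 1] dynomial_add[of b a 1 k] by (simp add: add.commute)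
qed simp

lemma drop_dynomial: "drop (2 * i) (dynomial a b k) = dynomial a b (k - i)"
proof (induction i arbitrary: k)
  case (Suc i)
  then show ?case
    by (cases k) simp_all
qed simp

lemma dynomial_suffix:
  assumes "xs @ w = dynomial a b k"
  shows "\<exists>j. w = dynomial a b j \<or> w = b # dynomial a b j"
proof -
  have w: "w = drop (length xs) (dynomial a b k)"
    by (simp flip: assms)
  show ?thesis
  proof (cases "even (length xs)")
    case True
    then show ?thesis
      using w drop_dynomial by (metis evenE)
  next
    case False
    then obtain i where "length xs = Suc (2 * i)"
      by (metis oddE Suc_eq_plus1)
    with w have "w = tl (dynomial a b (k - i))"
      by (simp add: drop_Suc flip: tl_drop drop_dynomial)
    then show ?thesis
      \<comment> \<open>An odd cut leaves the \<open>b\<close> of a broken pair in front. If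
        \<open>k - i\<close> is 0, \<open>tl\<close> returns the empty word, which is covered by
        \<open>j = 0\<close>.\<close>
      by (cases "k - i") (auto intro: exI[of _ 0])
  qed
qed

lemma tuple_equiv_dynomial:
  assumes "tuple_equiv (dynomial a b k) xs"
  shows "xs \<in> {dynomial a b k, dynomial b a k}"
  using assms rotate_dynomial[of _ a b k] rotate_dynomial[of _ b a k]
  by (auto simp: tuple_equiv_def rev_dynomial)

lemma is_solution_dynomial_commute:
  fixes a b :: "'a::field"
  shows "is_solution (dynomial a b k) \<longleftrightarrow> is_solution (dynomial b a k)"
  by (metis is_solution_rotate1 rotate1_dynomial)

text \<open>This is \<open>uP + v\<close>, where \<open>P\<close> is the matrix of \<open>[a, b]\<close>.\<close>

definition lin_comb_matrix :: "'a::comm_ring_1 \<Rightarrow> 'a \<Rightarrow> 'a \<Rightarrow> 'a \<Rightarrow> 'a^2^2" where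
  "lin_comb_matrix a b u v =
     vector [vector [u * (a * b - 1) + v, - u * b], vector [u * a, v - u]]"

lemma lin_comb_matrix_nth [simp]:
  "lin_comb_matrix a b u v $ 1 $ 1 = u * (a * b - 1) + v"
  "lin_comb_matrix a b u v $ 1 $ 2 = - u * b"
  "lin_comb_matrix a b u v $ 2 $ 1 = u * a"
  "lin_comb_matrix a b u v $ 2 $ 2 = v - u"
  by (simp_all add: lin_comb_matrix_def)

text \<open>Cayley-Hamilton gives P^2 = tP - 1 with t = ab - 2, hence (uP + v)P = (tu + v)P -
  u.\<close>

lemma Mn_dynomial_Suc:
  assumes "Mn (dynomial a b k) = lin_comb_matrix a b u v"
  shows "Mn (dynomial a b (Suc k)) = lin_comb_matrix a b (u * (a * b - 2) + v) (- u)"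
  by (simp add: assms vec_eq_iff forall_2 matrix_mult_nth_2 algebra_simps)

text \<open>The form is the determinant of uP + v for P of trace \<open>t\<close> and determinant 1,
  so multiplication by P preserves it.\<close>

lemma norm_form_step:
  fixes t u v :: "'a::comm_ring_1"
  assumes "u^2 + u * v * t + v^2 = 1"
  shows "(u * t + v)^2 + (u * t + v) * (- u) * t + (- u)^2 = 1"
  using assms by (simp add: power2_eq_square algebra_simps)

lemma Mn_dynomial_form:
  obtains u v where "Mn (dynomial a b k) = lin_comb_matrix a b u v"
    "u^2 + u * v * (a * b - 2) + v^2 = 1"
proof -
  have "\<exists>u v. Mn (dynomial a b k) = lin_comb_matrix a b u v \<and>
      u^2 + u * v * (a * b - 2) + v^2 = 1"
  proof (induction k)
    case 0
    have "Mn (dynomial a b 0) = lin_comb_matrix a b 0 1"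
      by (simp add: vec_eq_iff forall_2 mat_def)
    then show ?case
      by (intro exI[of _ 0] exI[of _ 1]) simp
  next
    case (Suc k)
    then show ?case
      using Mn_dynomial_Suc norm_form_step by blast
  qed
  with that show thesis
    by blast
qed

lemma is_solution_if_scalar:
  fixes v :: "'a::idom"
  assumes "Mn xs = lin_comb_matrix a b 0 v" "v^2 = 1"
  shows "is_solution xs"
  using assms by (auto simp: is_solution_def vec_eq_iff forall_2 mat_def power2_eq_1_iff)

lemma even_word_solution:
  fixes a b :: "'a::field"
  assumes "a \<noteq> 0" "b \<noteq> 0" and e: "(Mn (dynomial a b k) $ 1 $ 1)^2 = 1"
  shows "is_solution (dynomial a b k) \<or> is_solution (dynomial a b (Suc k))"
proof -
  obtain u v where M: "Mn (dynomial a b k) = lin_comb_matrix a b u v"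
    and uv: "u^2 + u * v * (a * b - 2) + v^2 = 1"
    by (rule Mn_dynomial_form)
  \<comment> \<open>The square of the upper left entry minus the determinant factors; the last
    factor is the coefficient of P in the next power.\<close>
  have "(a * b) * (u * (u * (a * b - 2) + v)) =
      (u * (a * b - 1) + v)^2 - (u^2 + u * v * (a * b - 2) + v^2)"
    by (simp add: power2_eq_square algebra_simps)
  also have "\<dots> = 0"
    using e uv by (simp add: M)
  finally have "u = 0 \<or> u * (a * b - 2) + v = 0"
    using assms(1,2) by simp
  then show ?thesis
  proof
    assume "u = 0"
    then show ?thesis
      using is_solution_if_scalar M uv by fastforce
  next
    assume z: "u * (a * b - 2) + v = 0"
    then have "(- u)^2 = 1"
      using norm_form_step[OF uv] by simp
    then show ?thesis
      using is_solution_if_scalar Mn_dynomial_Suc[OF M] z by metis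
  qed
qed

lemma odd_word_square:
  fixes a b :: "'a::field"
  assumes "a \<noteq> 0" "b \<noteq> 0" and e: "(Mn (b # dynomial a b k) $ 1 $ 1)^2 = 1"
  shows "is_square (b^2 + 4 * (inverse a * b) * (inverse a * b - 1))"
proof -
  obtain u v where M: "Mn (dynomial a b k) = lin_comb_matrix a b u v"
    and uv: "u^2 + u * v * (a * b - 2) + v^2 = 1"
    by (rule Mn_dynomial_form)
  \<comment> \<open>Here pP + q is the power of P with exponent \<open>Suc k\<close>: the extra
    letter \<open>b\<close> makes the upper left entry \<open>b * p\<close>.\<close>
  define t where "t = a * b - 2"
  define p where "p = u * t + v"
  define q where "q = - u"
  have "Mn (b # dynomial a b k) $ 1 $ 1 = b * p"
    by (simp add: M matrix_mult_nth_2 p_def t_def algebra_simps)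
  with e have bp: "b^2 * p^2 = 1"
    by (simp add: power_mult_distrib)
  have pq: "p^2 + p * q * t + q^2 = 1"
    unfolding p_def q_def using norm_form_step[OF uv] by (simp add: t_def)
  \<comment> \<open>Completing the square in \<open>q\<close>, scaled by \<open>b\<close> so that
    \<open>p\<close> enters only through \<open>b * p\<close>, whose square is 1.\<close>
  have "(b * (2 * q + t * p))^2 = b^2 * (4 * (p^2 + p * q * t + q^2)) + (t^2 - 4) * (b^2 * p^2)"
    by (simp add: power2_eq_square algebra_simps)
  also have "\<dots> = 4 * b^2 + t^2 - 4"
    by (simp add: pq bp)
  also have "\<dots> = 4 * b^2 + a^2 * b^2 - 4 * (a * b)"
    by (simp add: t_def power2_eq_square algebra_simps)
  also have "\<dots> = a^2 * (b^2 + 4 * (inverse a * b) * (inverse a * b - 1))"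
    using \<open>a \<noteq> 0\<close> by (simp add: field_simps power2_eq_square)
  finally have "b^2 + 4 * (inverse a * b) * (inverse a * b - 1)
      = (b * (2 * q + t * p) / a)^2"
    using \<open>a \<noteq> 0\<close> by (simp add: power_divide)
  then show ?thesis
    by (auto simp: is_nth_power_def)
qed

text \<open>Pigeonhole: two powers of P coincide in the finite set of matrices, and a right inverse
  cancels the smaller one.\<close>

lemma ex_dynomial_solution:
  fixes a b :: "'a::{field,finite}"
  shows "\<exists>k\<ge>1. is_solution (dynomial a b k)"
proof -
  have inv: "\<exists>N. Mn xs ** N = mat 1" for xs :: "'a list"
  proof (induction xs)
    case (Cons x xs)
    then obtain N where N: "Mn xs ** N = mat 1" ..
    define E :: "'a^2^2" where "E = vector [vector [0, 1], vector [-1, x]]"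
    have "elementary_matrix x ** E = mat 1"
      by (simp add: vec_eq_iff forall_2 matrix_mult_nth_2 mat_def E_def)
    then have "Mn (x # xs) ** (E ** N) = mat 1"
      using N by (metis Mn.simps(2) matrix_mul_assoc matrix_mul_rid)
    then show ?case ..
  qed (auto intro: exI[of _ "mat 1"])
  have "\<not> inj (\<lambda>k. Mn (dynomial a b k))"
    using finite_imageD[of "\<lambda>k. Mn (dynomial a b k)" UNIV] by auto
  then obtain i j where "i < j" and ij: "Mn (dynomial a b i) = Mn (dynomial a b j)"
    by (metis (no_types, lifting) injI linorder_neqE_nat)
  then have "Mn (dynomial a b (j - i)) ** Mn (dynomial a b i) = Mn (dynomial a b i)"
    using dynomial_add[of a b i "j - i"] ij by (metis Mn_append le_add_diff_inverse less_imp_le)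
  then have "Mn (dynomial a b (j - i)) = mat 1"
    using inv by (metis matrix_mul_assoc matrix_mul_rid)
  then show ?thesis
    using \<open>i < j\<close> by (intro exI[of _ "j - i"]) (simp add: is_solution_def)
qed

theorem theorem5p8:
  fixes a b :: "'k::{field,finite}"
  assumes "CHAR('k) \<noteq> 2"
    and "a \<noteq> 0" and "b \<noteq> 0" and "a \<noteq> b"
    and "a \<notin> {1, -1}" and "b \<notin> {1, -1}"
    and "\<not> is_square (a^2 + 4 * (a * inverse b) * (a * inverse b - 1))"
    and "\<not> is_square (b^2 + 4 * (inverse a * b) * (inverse a * b - 1))"
  shows "irreducible_solution (dynomial_minimal_solution a b)"
proof -
  define n where "n = (LEAST k. k \<ge> 1 \<and> is_solution (dynomial a b k))"
  have n: "n \<ge> 1" "is_solution (dynomial a b n)"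
    using LeastI_ex[OF ex_dynomial_solution[of a b]] by (simp_all add: n_def)
  have n_le: "n \<le> k" if "k \<ge> 1" "is_solution (dynomial a b k)" for k
    unfolding n_def using that by (intro Least_le) simp
  \<comment> \<open>The lower left entry of P is \<open>a\<close>. Excluding a single pair secures
    the length of at least 3 that irreducibility demands.\<close>
  have "\<not> is_solution (dynomial a b 1)"
    using \<open>a \<noteq> 0\<close> by (auto simp: is_solution_def vec_eq_iff forall_2 matrix_mult_nth_2 mat_def)
  with n have "n \<ge> 2"
    by (metis One_nat_def Suc_1 not_less_eq_eq le_antisym)
  have False if "reducible_solution (dynomial a b n)"
  proof -
    from that obtain as bs where as: "length as \<ge> 3" and bs: "length bs \<ge> 3" "is_solution bs"
      and eqv: "tuple_equiv (dynomial a b n) (tuple_sum as bs)"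
      by (auto simp: reducible_solution_def)
    \<comment> \<open>The interior of \<open>bs\<close> survives unchanged as a suffix of the sum,
      behind exactly \<open>length as\<close> entries.\<close>
    define w where "w = butlast (tl bs)"
    have "bs = hd bs # w @ [last bs]"
      unfolding w_def using bs(1) by (cases bs) auto
    then have w: "(Mn w $ 1 $ 1)^2 = 1"
      using is_solution_upper_left bs(2) by (metis power2_eq_1_iff)
    have "w \<noteq> []"
      using bs(1) by (auto simp: w_def simp flip: length_greater_0_conv)
    obtain c d where cd: "(c, d) \<in> {(a, b), (b, a)}" and sum: "tuple_sum as bs = dynomial c d n"
      using tuple_equiv_dynomial[OF eqv] by auto
    have "\<exists>xs. xs @ w = tuple_sum as bs \<and> length xs = length as"
      using as by (intro exI[of _ "[hd as + last bs] @ butlast (tl as) @ [last as + hd bs]"])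
        (simp add: tuple_sum_def w_def)
    then obtain xs where xs: "xs @ w = dynomial c d n" "length xs = length as"
      by (auto simp: sum)
    have len: "length w + 3 \<le> 2 * n"
      using arg_cong[OF xs(1), of length] xs(2) as by simp
    have minimal: "n \<le> k" if "k \<ge> 1" "is_solution (dynomial c d k)" for k
      using n_le[of k] that cd is_solution_dynomial_commute by auto
    have nz: "c \<noteq> 0" "d \<noteq> 0"
      using cd \<open>a \<noteq> 0\<close> \<open>b \<noteq> 0\<close> by auto
    obtain j where "w = dynomial c d j \<or> w = d # dynomial c d j"
      using dynomial_suffix[OF xs(1)] by auto
    then show False
    proof
      assume wj: "w = dynomial c d j"
      with \<open>w \<noteq> []\<close> have "j \<ge> 1"
        by (cases j) auto
      then show False
        \<comment> \<open>The gap of three gives 2j + 3 \<le> 2n, so even \<open>Suc j\<close> lies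
          below \<open>n\<close>.\<close>
        using even_word_solution[OF nz] w minimal[of j] minimal[of "Suc j"] len
        by (fastforce simp: wj)
    next
      assume "w = d # dynomial c d j"
      \<comment> \<open>The order (a, b) contradicts the second discriminant hypothesis, the order
        (b, a) the first.\<close>
      then show False
        using odd_word_square[OF nz] w cd assms(7,8) by (auto simp: mult.commute)
    qed
  qed
  then show ?thesis
    using n(2) \<open>n \<ge> 2\<close>
    unfolding irreducible_solution_def dynomial_minimal_solution_def n_def[symmetric] by auto
qed

end
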